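(* For any graph $G$ of order $n$ and size $m$, \[\frac{2m}{n^2}\le 1-\frac{2}{\omega(G)}+\frac{\alpha(G)}{n}.\]
   Context: Graphs are finite, simple and have a nonempty vertex set. The order of a graph is its number of vertices and its size is its number of edges. $\omega(G)$ is the clique number and $\alpha(G)$ the independence number of $G$. *)

theory Defs
  imports Complex_Main "HOL-Library.Ramsey"
begin

locale finite_simple_graph =
  fixes V :: "'a set" and E :: "'a set set"
  assumes finite_vertices: "finite V"
    and vertices_nonempty: "V \<noteq> {}"
    and edges: "E \<subseteq> [V]\<^bsup>2\<^esup>"

definition clique_number :: "'a set \<Rightarrow> 'a set set \<Rightarrow> nat"
  where "clique_number V E = Max {card K | K. K \<subseteq> V \<and> clique K E}"

definition independence_number :: "'a set \<Rightarrow> 'a set set \<Rightarrow> nat"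
  where "independence_number V E = Max {card I | I. I \<subseteq> V \<and> indep I E}"

end

theory Submission
  imports Defs
begin

text \<open>
  The proof is in the style of Motzkin and Straus. Let the symmetric matrix \<open>B\<close> have diagonal
  entries \<open>1 + \<alpha>\<close>, entries 0 at edges and 1 at non-edges; then \<open>x\<^sup>T B x \<ge> 2 (\<Sum>x)\<^sup>2 / \<omega>\<close> for
  every \<open>x \<ge> 0\<close>, and the all-ones vector gives the bound on the number of edges. The inequality
  is shown by induction on the support \<open>U\<close> of \<open>x\<close>: let \<open>c v\<close> be the number of maximum cliques
  of the graph induced on \<open>U\<close> that contain \<open>v\<close>, and \<open>N\<close> the number of all of them. An exchange
  argument gives \<open>B c \<ge> 2 N\<close> on \<open>U\<close>, and subtracting the largest possible multiple of \<open>c\<close>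
  from \<open>x\<close> shrinks the support.
\<close>

text \<open>These are the entries of \<open>B\<close>. The parameter \<open>a\<close> may be any
  upper bound for the independent sets, not only \<alpha>.\<close>

definition pair_weight :: "'a set set \<Rightarrow> nat \<Rightarrow> 'a \<Rightarrow> 'a \<Rightarrow> real"
  where "pair_weight E a u v = (if u = v then 1 + real a else if {u, v} \<in> E then 0 else 1)"

lemma pair_weight_commute: "pair_weight E a u v = pair_weight E a v u"
  by (auto simp: pair_weight_def insert_commute)

definition cliques_of_card :: "'a set \<Rightarrow> 'a set set \<Rightarrow> nat \<Rightarrow> 'a set set"
  where "cliques_of_card U E r = {K. K \<subseteq> U \<and> clique K E \<and> card K = r}"

lemma finite_cliques_of_card: "finite U \<Longrightarrow> finite (cliques_of_card U E r)"
  by (rule finite_subset[of _ "Pow U"]) (auto simp: cliques_of_card_def)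

text \<open>Only over the cliques counted on the left does row \<open>v\<close> of the matrix sum to
  less than 2, namely to 1. The right-hand side is the surplus that the diagonal entry
  \<open>1 + a\<close> yields over the maximum cliques through \<open>v\<close>.\<close>

lemma card_cliques_one_nonneighbour_le:
  assumes U: "finite U" "v \<in> U"
    and a: "\<And>I. I \<subseteq> U \<Longrightarrow> indep I E \<Longrightarrow> card I \<le> a"
    and r: "\<And>K. K \<subseteq> U \<Longrightarrow> clique K E \<Longrightarrow> card K \<le> r"
  shows "card {K \<in> cliques_of_card U E r. v \<notin> K \<and> card {u \<in> K. {v, u} \<notin> E} = 1}
    \<le> card {K \<in> cliques_of_card U E r. v \<in> K} * (a - 1)"
proof -
  let ?M = "cliques_of_card U E r"
  let ?B = "{K \<in> ?M. v \<notin> K \<and> card {u \<in> K. {v, u} \<notin> E} = 1}"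
  let ?L = "{K \<in> ?M. v \<in> K}"
  define W where "W L = {w \<in> U - L. {v, w} \<notin> E \<and> clique (insert w (L - {v})) E}" for L
  have fin: "finite ?M" "finite ?L" using finite_cliques_of_card[OF U(1)] by simp_all
  have finW: "finite (W L)" for L using U by (auto simp: W_def)
  have cardW: "card (W L) \<le> a - 1" if L: "L \<in> ?L" for L
  proof -
    have LU: "L \<subseteq> U" "clique L E" "card L = r" "v \<in> L" using L by (auto simp: cliques_of_card_def)
    have fL: "finite L" using LU U finite_subset by blast
    \<comment> \<open>Otherwise \<open>y\<close> and \<open>z\<close> could together replace
      \<open>v\<close> in \<open>L\<close>, which gives a clique with \<open>r + 1\<close>
      elements.\<close>
    have "{y, z} \<notin> E" if y: "y \<in> W L" and z: "z \<in> W L" and yz: "y \<noteq> z" for y z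
    proof
      assume "{y, z} \<in> E"
      then have "clique (insert y (insert z (L - {v}))) E"
        using y z by (auto simp: W_def clique_def insert_commute)
      then have "card (insert y (insert z (L - {v}))) \<le> r"
        using y z LU by (intro r) (auto simp: W_def)
      moreover have "card (insert y (insert z (L - {v}))) = Suc (Suc (card (L - {v})))"
        using y z yz fL by (simp add: W_def)
      moreover have "Suc (card (L - {v})) = card L"
        using LU fL card.remove by metis
      ultimately show False using LU by simp
    qed
    then have "indep (insert v (W L)) E"
      by (auto simp: indep_def W_def insert_commute)
    then have "card (insert v (W L)) \<le> a" using U by (intro a) (auto simp: W_def)
    moreover have "v \<notin> W L" using LU by (auto simp: W_def)
    ultimately show ?thesis using finW[of L] by simp
  qed
  \<comment> \<open>Exchanging the only non-neighbour \<open>w\<close> of \<open>v\<close> in \<open>K\<close> for \<open>v\<close> gives a clique \<open>L\<close> through \<open>v\<close>;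
    the vertices \<open>w\<close> that lead to the same \<open>L\<close> form, together with \<open>v\<close>, an independent set.\<close>
  have "?B \<subseteq> (\<Union>L\<in>?L. (\<lambda>w. insert w (L - {v})) ` W L)"
  proof
    fix K assume K: "K \<in> ?B"
    then have KU: "K \<subseteq> U" "clique K E" "card K = r" "v \<notin> K" by (auto simp: cliques_of_card_def)
    have fK: "finite K" using KU U finite_subset by blast
    obtain w where w: "{u \<in> K. {v, u} \<notin> E} = {w}" using K by (auto simp: card_1_singleton_iff)
    let ?K = "insert v (K - {w})"
    have wK: "w \<in> K" "{v, w} \<notin> E" using w by auto
    have adj: "{v, u} \<in> E" if "u \<in> K" "u \<noteq> w" for u using w that by blast
    have "clique ?K E" using adj KU by (auto simp: clique_def insert_commute)
    moreover have "card ?K = r"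
    proof -
      have "card ?K = Suc (card (K - {w}))" using fK KU by simp
      also have "\<dots> = card K" using fK wK card.remove by metis
      finally show ?thesis using KU by simp
    qed
    moreover have "?K \<subseteq> U" using KU U by blast
    ultimately have L: "?K \<in> ?L" by (simp add: cliques_of_card_def)
    have eq: "insert w (?K - {v}) = K" using KU wK by auto
    have "w \<in> W ?K" unfolding W_def mem_Collect_eq eq using KU wK by auto
    then show "K \<in> (\<Union>L\<in>?L. (\<lambda>w. insert w (L - {v})) ` W L)" using L eq by blast
  qed
  then have "card ?B \<le> card (\<Union>L\<in>?L. (\<lambda>w. insert w (L - {v})) ` W L)"
    using fin finW by (intro card_mono) auto
  also have "\<dots> \<le> (\<Sum>L\<in>?L. card ((\<lambda>w. insert w (L - {v})) ` W L))"
    by (rule card_UN_le[OF fin(2)])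
  also have "\<dots> \<le> (\<Sum>L\<in>?L. a - 1)"
    by (intro sum_mono order_trans[OF card_image_le[OF finW]] cardW)
  finally show ?thesis by simp
qed

text \<open>This is the row inequality \<open>B c \<ge> 2 N\<close> at \<open>v\<close>, with the
  sum in \<open>c\<close> taken clique by clique.\<close>

lemma sum_pair_weight_cliques_ge:
  assumes U: "finite U" "v \<in> U"
    and a: "\<And>I. I \<subseteq> U \<Longrightarrow> indep I E \<Longrightarrow> card I \<le> a"
    and r: "\<And>K. K \<subseteq> U \<Longrightarrow> clique K E \<Longrightarrow> card K \<le> r"
  shows "2 * real (card (cliques_of_card U E r))
    \<le> (\<Sum>K\<in>cliques_of_card U E r. \<Sum>u\<in>K. pair_weight E a v u)"
proof -
  let ?M = "cliques_of_card U E r"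
  let ?B = "{K \<in> ?M. v \<notin> K \<and> card {u \<in> K. {v, u} \<notin> E} = 1}"
  let ?L = "{K \<in> ?M. v \<in> K}"
  have fM: "finite ?M" using U finite_cliques_of_card by auto
  have "card {v} \<le> a" using U by (intro a) (auto simp: indep_def)
  then have a1: "1 \<le> a" by simp
  \<comment> \<open>A clique through \<open>v\<close> already gets
    \<open>1 + a = 2 + (a - 1)\<close> from the diagonal. Over any other clique the sum counts the
    non-neighbours of \<open>v\<close>; there is at least one, as \<open>v\<close> cannot be added
    to a maximum clique, so the sum misses 2 only if there is exactly one.\<close>
  have ge: "2 + (real a - 1) * of_bool (K \<in> ?L) - of_bool (K \<in> ?B) \<le> (\<Sum>u\<in>K. pair_weight E a v u)"
    if K: "K \<in> ?M" for K
  proof -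
    have KU: "K \<subseteq> U" "clique K E" "card K = r" using K by (auto simp: cliques_of_card_def)
    have fK: "finite K" using KU U finite_subset by blast
    show ?thesis
    proof (cases "v \<in> K")
      case True
      have "pair_weight E a v v \<le> (\<Sum>u\<in>K. pair_weight E a v u)"
        using True fK by (intro member_le_sum) (auto simp: pair_weight_def)
      then show ?thesis using True K by (simp add: pair_weight_def)
    next
      case False
      let ?N = "{u \<in> K. {v, u} \<notin> E}"
      have "(\<Sum>u\<in>K. pair_weight E a v u) = (\<Sum>u\<in>K. if {v, u} \<notin> E then 1 else 0)"
        using False by (intro sum.cong) (auto simp: pair_weight_def)
      also have "\<dots> = real (card ?N)" using fK by (simp add: sum.If_cases Int_def)
      finally have s: "(\<Sum>u\<in>K. pair_weight E a v u) = real (card ?N)" .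
      have "?N \<noteq> {}"
      proof
        assume "?N = {}"
        then have "clique (insert v K) E" using KU by (auto simp: clique_def insert_commute)
        then have "card (insert v K) \<le> r" using KU U by (intro r) auto
        then show False using False fK KU by simp
      qed
      then have "card ?N \<noteq> 0" using fK by simp
      then show ?thesis using False K s by (auto simp: of_bool_def)
    qed
  qed
  have "real (card ?B) \<le> real (card ?L * (a - 1))"
    using card_cliques_one_nonneighbour_le[OF U a r] by (simp only: of_nat_le_iff)
  then have "real (card ?B) \<le> real (card ?L) * (real a - 1)" using a1 by (simp add: of_nat_diff)
  then have "2 * real (card ?M) \<le> 2 * real (card ?M) + (real a - 1) * real (card ?L) - real (card ?B)"
    by (simp add: mult.commute)
  also have "\<dots> = (\<Sum>K\<in>?M. 2 + (real a - 1) * of_bool (K \<in> ?L) - of_bool (K \<in> ?B))"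
    using fM by (simp add: sum.distrib sum_subtractf sum_distrib_left[symmetric] Int_def)
  also have "\<dots> \<le> (\<Sum>K\<in>?M. \<Sum>u\<in>K. pair_weight E a v u)"
    by (intro sum_mono ge)
  finally show ?thesis .
qed

text \<open>The vertex set stays fixed and only the support of \<open>x\<close> shrinks, so the
  bounds \<open>a\<close> and \<open>w\<close> serve for every induced subgraph met in the
  induction.\<close>

theorem weighted_clique_independence_bound:
  fixes x :: "'a \<Rightarrow> real"
  assumes V: "finite V"
    and a: "\<And>I. I \<subseteq> V \<Longrightarrow> indep I E \<Longrightarrow> card I \<le> a"
    and w: "\<And>K. K \<subseteq> V \<Longrightarrow> clique K E \<Longrightarrow> card K \<le> w"
    and x: "\<And>v. v \<in> V \<Longrightarrow> 0 \<le> x v"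
  shows "2 * (\<Sum>v\<in>V. x v)\<^sup>2 \<le> real w * (\<Sum>u\<in>V. \<Sum>v\<in>V. pair_weight E a u v * x u * x v)"
  using x
proof (induction "card {v \<in> V. 0 < x v}" arbitrary: x rule: less_induct)
  case less
  define U where "U = {v \<in> V. 0 < x v}"
  have U: "finite U" "U \<subseteq> V" using V by (auto simp: U_def)
  have x0: "x v = 0" if "v \<in> V" "v \<notin> U" for v using that less.prems[of v] by (auto simp: U_def)
  show ?case
  proof (cases "U = {}")
    case True
    then have "x v = 0" if "v \<in> V" for v using that x0 by blast
    then show ?thesis by simp
  next
    case False
    \<comment> \<open>The clique number of the graph induced on the support can be smaller than
      \<open>w\<close>; the final estimate needs only \<open>r \<le> w\<close>.\<close>
    define r where "r = Max (card ` {K. K \<subseteq> U \<and> clique K E})"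
    have fC: "finite (card ` {K. K \<subseteq> U \<and> clique K E})" using U by auto
    have r: "card K \<le> r" if "K \<subseteq> U" "clique K E" for K
      unfolding r_def using fC that by (intro Max_ge) auto
    have "{} \<in> {K. K \<subseteq> U \<and> clique K E}" by (simp add: clique_def)
    then have "r \<in> card ` {K. K \<subseteq> U \<and> clique K E}"
      unfolding r_def using fC by (intro Max_in) auto
    then obtain K0 where K0: "K0 \<subseteq> U" "clique K0 E" "card K0 = r" by auto
    have rw: "r \<le> w" using w[of K0] K0 U by auto
    obtain v0 where "v0 \<in> U" using False by blast
    then have r1: "1 \<le> r" using r[of "{v0}"] by (auto simp: clique_def)
    define M where "M = cliques_of_card U E r"
    have fM: "finite M" unfolding M_def using U finite_cliques_of_card by auto
    have MU: "K \<subseteq> U" "card K = r" if "K \<in> M" for K using that by (auto simp: M_def cliques_of_card_def)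
    have K0M: "K0 \<in> M" using K0 by (simp add: M_def cliques_of_card_def)
    define N where "N = real (card M)"
    define c where "c v = (\<Sum>K\<in>M. of_bool (v \<in> K) :: real)" for v
    have c_nonneg: "0 \<le> c v" for v by (simp add: c_def sum_nonneg)
    have c0: "c v = 0" if "v \<notin> U" for v unfolding c_def using that MU by (intro sum.neutral) auto
    \<comment> \<open>Double counting of incidences between vertices and maximum cliques. The
      constant function 1 gives the total of \<open>c\<close>, and a row of \<open>B\<close> gives
      an entry of \<open>B c\<close>.\<close>
    have sum_c: "(\<Sum>v\<in>V. f v * c v) = (\<Sum>K\<in>M. \<Sum>v\<in>K. f v)" for f
    proof -
      have "(\<Sum>v\<in>V. f v * c v) = (\<Sum>v\<in>V. \<Sum>K\<in>M. f v * of_bool (v \<in> K))"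
        by (simp add: c_def sum_distrib_left)
      also have "\<dots> = (\<Sum>K\<in>M. \<Sum>v\<in>V. f v * of_bool (v \<in> K))" by (rule sum.swap)
      also have "\<dots> = (\<Sum>K\<in>M. \<Sum>v\<in>K. f v)"
      proof (rule sum.cong[OF refl])
        fix K assume "K \<in> M"
        then have "K \<subseteq> V" using MU U by blast
        then show "(\<Sum>v\<in>V. f v * of_bool (v \<in> K)) = (\<Sum>v\<in>K. f v)"
          using V by (intro sum.mono_neutral_cong_right) auto
      qed
      finally show ?thesis .
    qed
    have total_c: "(\<Sum>v\<in>V. c v) = r * N"
      using sum_c[of "\<lambda>_. 1"] MU by (simp add: N_def)
    have Bc: "2 * N \<le> (\<Sum>u\<in>V. pair_weight E a v u * c u)" if "v \<in> U" for v
      unfolding sum_c unfolding N_def M_def using U that a r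
      by (intro sum_pair_weight_cliques_ge) auto
    \<comment> \<open>The row inequalities are known on \<open>U\<close> only, so the test vector
      has to vanish off \<open>U\<close>. Both the remainder \<open>x - s c\<close> and
      \<open>c\<close> itself qualify.\<close>
    have Bz: "2 * N * (\<Sum>v\<in>V. z v) \<le> (\<Sum>v\<in>V. z v * (\<Sum>u\<in>V. pair_weight E a v u * c u))"
      if z: "\<And>v. v \<in> V \<Longrightarrow> 0 \<le> z v" "\<And>v. v \<in> V \<Longrightarrow> v \<notin> U \<Longrightarrow> z v = 0" for z
    proof -
      have "z v * (2 * N) \<le> z v * (\<Sum>u\<in>V. pair_weight E a v u * c u)" if "v \<in> V" for v
        using that z[of v] Bc[of v] by (cases "v \<in> U") (auto intro: mult_left_mono)
      then have "(\<Sum>v\<in>V. z v * (2 * N)) \<le> (\<Sum>v\<in>V. z v * (\<Sum>u\<in>V. pair_weight E a v u * c u))"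
        by (intro sum_mono)
      then show ?thesis by (simp only: sum_distrib_right[symmetric] mult.commute[of "2 * N"])
    qed
    define P where "P = {v \<in> U. 0 < c v}"
    have fP: "finite P" using U by (simp add: P_def)
    have "K0 \<noteq> {}" using K0 r1 by auto
    then obtain k where k: "k \<in> K0" by blast
    have "1 \<le> c k" unfolding c_def using fM K0M k
      member_le_sum[of K0 M "\<lambda>K. of_bool (k \<in> K) :: real"] by auto
    then have "k \<in> P" using k K0 by (auto simp: P_def)
    then have neP: "P \<noteq> {}" by blast
    \<comment> \<open>The largest \<open>s\<close> for which \<open>x - s c\<close> stays
      nonnegative. A coordinate \<open>p\<close> where the minimum is attained becomes 0 and leaves
      the support.\<close>
    define s where "s = Min ((\<lambda>v. x v / c v) ` P)"
    have "s \<in> (\<lambda>v. x v / c v) ` P" unfolding s_def using fP neP by (intro Min_in) auto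
    then obtain p where p: "p \<in> P" "s = x p / c p" by blast
    have s0: "0 \<le> s" using p by (auto simp: P_def U_def)
    have sle: "s * c v \<le> x v" if "v \<in> V" for v
    proof (cases "v \<in> P")
      case True
      then have "s \<le> x v / c v" unfolding s_def using fP by (intro Min_le) auto
      then show ?thesis using True by (simp add: P_def field_simps)
    next
      case False
      then have "c v = 0" using c_nonneg[of v] c0 by (force simp: P_def)
      then show ?thesis using less.prems that by simp
    qed
    define z where "z v = x v - s * c v" for v
    have z: "0 \<le> z v" if "v \<in> V" for v using sle[OF that] by (simp add: z_def)
    have z0: "z v = 0" if "v \<in> V" "v \<notin> U" for v using x0[OF that] c0 that by (simp add: z_def)
    have "{v \<in> V. 0 < z v} \<subset> U"
    proof
      show "{v \<in> V. 0 < z v} \<subseteq> U" using z0 by force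
      have "z p = 0" "p \<in> U" using p by (auto simp: z_def P_def)
      then show "{v \<in> V. 0 < z v} \<noteq> U" by force
    qed
    then have "card {v \<in> V. 0 < z v} < card U" using U by (intro psubset_card_mono) auto
    then have IH: "2 * (\<Sum>v\<in>V. z v)\<^sup>2
        \<le> real w * (\<Sum>u\<in>V. \<Sum>v\<in>V. pair_weight E a u v * z u * z v)"
      using z unfolding U_def by (intro less.hyps) auto
    define S where "S = (\<Sum>v\<in>V. z v)"
    have S0: "0 \<le> S" unfolding S_def using z by (intro sum_nonneg) auto
    let ?Q = "\<lambda>f g. \<Sum>u\<in>V. \<Sum>v\<in>V. pair_weight E a u v * f u * g v"
    have Q_commute: "?Q c z = ?Q z c"
      by (subst sum.swap) (simp add: pair_weight_commute mult_ac)
    have Q_form: "?Q f c = (\<Sum>v\<in>V. f v * (\<Sum>u\<in>V. pair_weight E a v u * c u))" for f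
      by (simp add: sum_distrib_left mult_ac)
    have x_eq: "x v = z v + s * c v" for v by (simp add: z_def)
    have "?Q x x = ?Q z z + s * ?Q z c + s * ?Q c z + s\<^sup>2 * ?Q c c"
      unfolding x_eq by (simp add: algebra_simps power2_eq_square sum.distrib sum_distrib_left)
    then have Qx: "?Q x x = ?Q z z + 2 * s * ?Q z c + s\<^sup>2 * ?Q c c"
      unfolding Q_commute by simp
    have zc: "2 * N * S \<le> ?Q z c" unfolding Q_form S_def using z z0 by (rule Bz)
    have cc: "2 * N * (r * N) \<le> ?Q c c"
      unfolding Q_form total_c[symmetric] using c_nonneg c0 by (intro Bz)
    have N0: "0 \<le> N" by (simp add: N_def)
    have "2 * (\<Sum>v\<in>V. x v)\<^sup>2 = 2 * (S + s * (r * N))\<^sup>2"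
      unfolding x_eq by (simp add: sum.distrib sum_distrib_left[symmetric] S_def total_c)
    \<comment> \<open>One factor \<open>r\<close> is split off the cross term and the square term.
      What remains is bounded by \<open>zc\<close> and \<open>cc\<close>, while \<open>r\<close> is
      raised to \<open>w\<close>.\<close>
    also have "\<dots> = 2 * S\<^sup>2 + real r * (2 * s * (2 * N * S)) + real r * (s\<^sup>2 * (2 * N * (r * N)))"
      by (simp add: power2_eq_square algebra_simps)
    also have "\<dots> \<le> 2 * S\<^sup>2 + real w * (2 * s * (2 * N * S)) + real w * (s\<^sup>2 * (2 * N * (r * N)))"
      using rw s0 S0 N0 by (intro add_mono mult_right_mono) auto
    also have "\<dots> \<le> real w * ?Q z z + real w * (2 * s * ?Q z c) + real w * (s\<^sup>2 * ?Q c c)"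
      using IH zc cc s0 unfolding S_def by (intro add_mono mult_left_mono) auto
    also have "\<dots> = real w * ?Q x x" unfolding Qx by (simp add: algebra_simps)
    finally show ?thesis .
  qed
qed

lemma card_ordered_edges:
  assumes "finite E" and E: "E \<subseteq> [V]\<^bsup>2\<^esup>"
  shows "card {p \<in> V \<times> V. {fst p, snd p} \<in> E} = 2 * card E"
proof -
  let ?A = "\<lambda>e. {p. {fst p, snd p} = e}"
  have A: "finite (?A e) \<and> card (?A e) = 2" if "e \<in> E" for e
  proof -
    have "card e = 2" using E that by (auto simp: nsets_def)
    then obtain u v where "e = {u, v}" "u \<noteq> v" by (auto simp: card_2_iff)
    then have "?A e = {(u, v), (v, u)}" by (auto simp: doubleton_eq_iff)
    then show ?thesis using \<open>u \<noteq> v\<close> by simp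
  qed
  have "{p \<in> V \<times> V. {fst p, snd p} \<in> E} = (\<Union>e\<in>E. ?A e)"
    using E by (force simp: nsets_def)
  then have "card {p \<in> V \<times> V. {fst p, snd p} \<in> E} = (\<Sum>e\<in>E. card (?A e))"
    using A assms(1) by (simp only:) (intro card_UN_disjoint; auto)
  then show ?thesis using A by simp
qed

text \<open>The value of the quadratic form at the all-ones vector.\<close>

lemma sum_pair_weight:
  assumes V: "finite V" and E: "E \<subseteq> [V]\<^bsup>2\<^esup>"
  shows "(\<Sum>u\<in>V. \<Sum>v\<in>V. pair_weight E a u v)
    = (real (card V))\<^sup>2 + real a * real (card V) - 2 * real (card E)"
proof -
  have ne: "{u, v} \<in> E \<Longrightarrow> u \<noteq> v" for u v using E by (auto simp: nsets_def)
  have fE: "finite E" using V E finite_imp_finite_nsets finite_subset by blast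
  have "(\<Sum>u\<in>V. \<Sum>v\<in>V. pair_weight E a u v)
      = (\<Sum>u\<in>V. \<Sum>v\<in>V. 1 + (if u = v then real a else 0) - of_bool ({u, v} \<in> E))"
    using ne by (intro sum.cong refl) (auto simp: pair_weight_def)
  also have "\<dots> = (real (card V))\<^sup>2 + real a * real (card V)
      - (\<Sum>u\<in>V. \<Sum>v\<in>V. of_bool ({u, v} \<in> E))"
    using V by (simp add: sum.distrib sum_subtractf power2_eq_square algebra_simps)
  also have "(\<Sum>u\<in>V. \<Sum>v\<in>V. of_bool ({u, v} \<in> E) :: real)
      = (\<Sum>p\<in>V \<times> V. of_bool ({fst p, snd p} \<in> E))"
    by (simp add: sum.cartesian_product case_prod_beta)
  also have "\<dots> = real (card {p \<in> V \<times> V. {fst p, snd p} \<in> E})"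
    using V by (simp add: Int_def)
  finally show ?thesis using card_ordered_edges[OF fE E] by simp
qed

theorem theorem4p1:
  fixes V :: "'a set" and E :: "'a set set" and n m :: nat
  assumes "finite_simple_graph V E"
    and "card V = n"
    and "card E = m"
  shows "2 * real m / real n ^ 2
    \<le> 1 - 2 / real (clique_number V E) + real (independence_number V E) / real n"
proof -
  interpret finite_simple_graph V E by fact
  let ?a = "independence_number V E" and ?w = "clique_number V E"
  have fin: "finite (card ` {K. K \<subseteq> V \<and> Q K})" for Q using finite_vertices by auto
  have a: "card I \<le> ?a" if "I \<subseteq> V" "indep I E" for I
    unfolding independence_number_def setcompr_eq_image
    using that by (intro Max_ge[OF fin]) auto
  have w: "card K \<le> ?w" if "K \<subseteq> V" "clique K E" for K
    unfolding clique_number_def setcompr_eq_image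
    using that by (intro Max_ge[OF fin]) auto
  obtain v where "v \<in> V" using vertices_nonempty by blast
  then have w0: "0 < real ?w" using w[of "{v}"] by (auto simp: clique_def)
  have n0: "0 < real n" using assms(2) finite_vertices vertices_nonempty by (auto simp: card_gt_0_iff)
  \<comment> \<open>The all-ones vector gives the claim multiplied by \<open>w n^2\<close>, up to
    rearrangement; both factors are positive.\<close>
  have "2 * (real n)\<^sup>2 \<le> real ?w * ((real n)\<^sup>2 + real ?a * real n - 2 * real m)"
    using weighted_clique_independence_bound[where x = "\<lambda>_. 1" and E = E, OF finite_vertices a w] assms(2,3)
    by (simp add: sum_pair_weight[OF finite_vertices edges])
  then show ?thesis using w0 n0 by (simp add: field_simps power2_eq_square)
qed

end
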